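(* Let $\phi:\mathbb{H}\to\mathbb{C}$ be a conformal map, where $\mathbb{H}=\{z:\operatorname{Im} z>0\}$, let $w_0\in\mathbb{C}\setminus\phi(\mathbb{H})$, and let $\lambda>1$ and $\varepsilon>0$. For $n\ge0$ put \[ I_n=[\lambda^{n-1/2},\lambda^{n+1/2}],\qquad E_n=\{t\in I_n: |\phi(t)-w_0|\ge\varepsilon\}, \] \[ J_n=[n-\tfrac12,n+\tfrac12],\qquad F_n=\{t\in J_n: |\phi(t)-w_0|\ge\varepsilon\}, \] where for $t\in\mathbb{R}$, $\phi(t)$ denotes the angular limit of $\phi$ at $t$ and the sets $E_n$, $F_n$ consist of those $t$ at which this angular limit exists and satisfies the stated inequality. \begin{itemize} \item[(a)] If $\phi(\lambda^n i)\to w_0$ as $n\to\infty$, then \[\sum_{n=0}^{\infty}\frac{1}{\log(\lambda^n/\operatorname{cap}E_n)}<\infty.\] \item[(b)] If $\phi(n+i)\to w_0$ as $n\to\infty$, then \[\sum_{n=0}^{\infty}\frac{1}{\log(1/\operatorname{cap}F_n)}<\infty.\] \end{itemize}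
   Context: $\operatorname{cap}$ denotes logarithmic capacity. The angular limit of $\phi$ at a boundary point $t\in\mathbb{R}=\partial\mathbb{H}$ is the limit of $\phi(z)$ as $z\to t$ within any Stolz angle (sector with vertex $t$ symmetric about the vertical and of opening less than $\pi$) in $\mathbb{H}$. A term with $\operatorname{cap}E_n=0$ (respectively $\operatorname{cap}F_n=0$) is interpreted as $0$. *)

theory Defs
  imports "HOL-Complex_Analysis.Complex_Analysis" "HOL-Probability.Probability"
begin

definition upper_half_plane :: "complex set" where
  "upper_half_plane = {z. Im z > 0}"

text \<open>Stolz angle at the real point t with half-opening arctan k (k > 0):
  the sector with vertex t, symmetric about the vertical, of opening < pi.\<close>
definition stolz_angle :: "real \<Rightarrow> real \<Rightarrow> complex set" where
  "stolz_angle t k = {z. Im z > 0 \<and> \<bar>Re z - t\<bar> < k * Im z}"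

definition has_angular_limit :: "(complex \<Rightarrow> complex) \<Rightarrow> real \<Rightarrow> complex \<Rightarrow> bool" where
  "has_angular_limit f t L \<longleftrightarrow>
     (\<forall>k>0. (f \<longlongrightarrow> L) (at (complex_of_real t) within stolz_angle t k))"

text \<open>Logarithmic energy of a measure on the plane (kernel log(1/|z-w|), +infinity on the diagonal),
  split into its positive and negative parts.\<close>
definition log_energy :: "complex measure \<Rightarrow> ereal" where
  "log_energy \<mu> =
     enn2ereal (\<integral>\<^sup>+ z. \<integral>\<^sup>+ w. (if z = w then \<infinity> else ennreal (max 0 (- ln (cmod (z - w))))) \<partial>\<mu> \<partial>\<mu>)
   - enn2ereal (\<integral>\<^sup>+ z. \<integral>\<^sup>+ w. (if z = w then 0 else ennreal (max 0 (ln (cmod (z - w))))) \<partial>\<mu> \<partial>\<mu>)"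

definition robin_constant :: "complex set \<Rightarrow> ereal" where
  "robin_constant K =
     (INF \<mu> \<in> {\<mu>. prob_space \<mu> \<and> sets \<mu> = sets borel \<and> emeasure \<mu> K = 1}. log_energy \<mu>)"

definition cap_compact :: "complex set \<Rightarrow> real" where
  "cap_compact K = (if robin_constant K = \<infinity> then 0 else exp (- real_of_ereal (robin_constant K)))"

definition log_capacity :: "complex set \<Rightarrow> real" where
  "log_capacity E = Sup {cap_compact K | K. compact K \<and> K \<subseteq> E}"

end

theory Submission
  imports Defs
begin

text \<open>
  Let \<open>g = \<phi> - w0\<close>, which is univalent and without zeros on the half-plane. A branch of \<open>log g\<close> has
  an image containing no disc of radius greater than \<open>\<pi>\<close>, so Bloch's theorem bounds its derivative at
  \<open>z\<close> by \<open>12 \<pi> / Im z\<close>; hence \<open>g\<close> tends to 0 uniformly on hyperbolically bounded neighbourhoods of the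
  given points.

  Let \<open>\<rho> = |g'|\<close> where \<open>|g| < \<epsilon>\<close>, and 0 elsewhere. The integral of \<open>\<rho>\<^sup>2\<close> is at most the area of a disc
  of radius \<open>\<epsilon>\<close>. On each ray from \<open>t \<in> E\<^sub>n\<close> up to height \<open>Y\<close> comparable to the length of the interval,
  \<open>|g|\<close> passes from at least \<open>\<epsilon>\<close> to almost 0. Averaging over the slopes in \<open>(-1, 1)\<close> gives
  \<open>\<integral> \<rho> k\<^sub>t \<ge> \<epsilon>/2\<close>, where \<open>k\<^sub>t(x, y) = 1/y\<close> on the cone \<open>|x - t| < y < Y\<close>. Integrate this against a
  probability measure \<open>\<mu>\<close> on \<open>E\<^sub>n\<close> and apply Cauchy-Schwarz. Since \<open>\<integral> k\<^sub>s k\<^sub>t \<le> 2 log (M / |s - t|)\<close>, the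
  energy of \<open>\<mu>\<close> is at least \<open>\<epsilon>\<^sup>2 / (8 D\<^sub>n) - log M\<close>, where \<open>D\<^sub>n\<close> is the integral of \<open>\<rho>\<^sup>2\<close> over the union of
  the cones. These unions overlap boundedly, so \<open>\<Sum> D\<^sub>n < \<infinity>\<close>.
\<close>

section \<open>Growth and area for univalent functions\<close>

text \<open>By Bloch's theorem with constant 1/12, a larger derivative would put a disc of radius
  greater than pi inside the image of \<open>f\<close>. The points of that disc at distance pi above
  and below its centre \<open>b\<close> differ by 2 pi i, so \<open>exp\<close> takes the same value
  at both, against injectivity.\<close>

lemma deriv_log_univalent_bound:
  assumes f: "f holomorphic_on upper_half_plane"
    and inj: "inj_on (\<lambda>z. exp (f z)) upper_half_plane"
    and a: "Im a > 0"
  shows "cmod (deriv f a) \<le> 12 * pi / Im a"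
proof (rule ccontr)
  assume "\<not> ?thesis"
  hence gt: "pi < Im a * cmod (deriv f a) / 12"
    using a by (simp add: field_simps)
  have sub: "ball a (Im a) \<subseteq> upper_half_plane"
  proof
    fix z assume "z \<in> ball a (Im a)"
    hence "\<bar>Im (a - z)\<bar> < Im a"
      using abs_Im_le_cmod[of "a - z"] by (simp add: dist_norm)
    thus "z \<in> upper_half_plane" by (simp add: upper_half_plane_def)
  qed
  obtain b where b: "ball b (Im a * cmod (deriv f a) / 12) \<subseteq> f ` ball a (Im a)"
    using Bloch[OF holomorphic_on_subset[OF f sub] a order_refl] by blast
  have "b + \<i> * of_real pi \<in> ball b (Im a * cmod (deriv f a) / 12)"
       "b - \<i> * of_real pi \<in> ball b (Im a * cmod (deriv f a) / 12)"
    using gt by (simp_all add: dist_norm norm_mult)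
  hence "b + \<i> * of_real pi \<in> f ` upper_half_plane" "b - \<i> * of_real pi \<in> f ` upper_half_plane"
    using b sub by blast+
  then obtain z1 z2 where z: "z1 \<in> upper_half_plane" "f z1 = b + \<i> * of_real pi"
      "z2 \<in> upper_half_plane" "f z2 = b - \<i> * of_real pi"
    by (metis imageE)
  have "exp (f z1) = exp (f z2)"
    unfolding z exp_eq by (rule exI[of _ 1]) auto
  hence "z1 = z2" by (rule inj_onD[OF inj _ z(1,3)])
  hence "Im (f z1) = Im (f z2)" by simp
  thus False using z by simp
qed

text \<open>This is a Harnack-type inequality. The half-plane of points with imaginary part at least
  \<open>c\<close> is convex, so the bound 12 pi / c on the derivative of a branch \<open>f\<close>
  of log g can be integrated along the segment from \<open>w\<close> to \<open>z\<close>. Only the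
  real part of \<open>f\<close>, which is log |g|, is then compared.\<close>

lemma nonvanishing_univalent_growth:
  assumes g: "g holomorphic_on upper_half_plane" "inj_on g upper_half_plane"
      "\<And>z. z \<in> upper_half_plane \<Longrightarrow> g z \<noteq> 0"
    and c: "c > 0" "Im z \<ge> c" "Im w \<ge> c"
  shows "cmod (g z) \<le> exp (12 * pi * cmod (z - w) / c) * cmod (g w)"
proof -
  have H: "convex upper_half_plane" "open upper_half_plane"
    unfolding upper_half_plane_def by (auto simp: convex_halfspace_Im_gt open_halfspace_Im_gt)
  have ii: "\<i> \<in> upper_half_plane" by (simp add: upper_half_plane_def)
  obtain f where f: "f holomorphic_on upper_half_plane"
      "\<And>x. x \<in> upper_half_plane \<Longrightarrow> exp (f x) = g x"
    using holomorphic_logarithm_exists[OF H g(1) g(3) ii] by blast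
  have inj: "inj_on (\<lambda>z. exp (f z)) upper_half_plane"
    using g(2) f(2) by (simp cong: inj_on_cong)
  have "cmod (f z - f w) \<le> (12 * pi / c) * cmod (z - w)"
  proof (rule field_differentiable_bound[of "{z. Im z \<ge> c}"])
    show "convex {z. Im z \<ge> c}" by (rule convex_halfspace_Im_ge)
    fix x assume x: "x \<in> {z. Im z \<ge> c}"
    hence xH: "x \<in> upper_half_plane" using c by (simp add: upper_half_plane_def)
    show "(f has_field_derivative deriv f x) (at x within {z. Im z \<ge> c})"
      using holomorphic_derivI[OF f(1) H(2) xH] by (rule has_field_derivative_at_within)
    have "cmod (deriv f x) \<le> 12 * pi / Im x"
      using deriv_log_univalent_bound[OF f(1) inj] xH by (simp add: upper_half_plane_def)
    also have "\<dots> \<le> 12 * pi / c"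
      using x c by (intro divide_left_mono) auto
    finally show "cmod (deriv f x) \<le> 12 * pi / c" .
  qed (use c in auto)
  hence "Re (f z) - Re (f w) \<le> 12 * pi * cmod (z - w) / c"
    using complex_Re_le_cmod[of "f z - f w"] by simp
  hence "exp (Re (f z)) \<le> exp (12 * pi * cmod (z - w) / c) * exp (Re (f w))"
    by (simp flip: exp_add)
  moreover have "cmod (g z) = exp (Re (f z))" "cmod (g w) = exp (Re (f w))"
    using f(2)[of z] f(2)[of w] c by (simp_all add: upper_half_plane_def flip: norm_exp_eq_Re)
  ultimately show ?thesis by simp
qed

section \<open>Areas of univalent images, computed in real coordinates\<close>

lemma continuous_on_vector2: "continuous_on A (\<lambda>p::real\<times>real. vector [fst p, snd p] :: real^2)"
  by (intro linear_continuous_on linear_conv_bounded_linear[THEN iffD1])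
     (auto simp: linear_iff vec_eq_iff forall_2)

text \<open>The change of variables for the area takes place in \<open>real^2\<close>, while
  Fubini's theorem is used on \<open>real \<times> real\<close>; this identification carries the
  area integral from one to the other. It suffices to compare the two measures on boxes.\<close>

lemma lborel_vec2_eq_distr:
  "(lborel :: (real^2) measure) = distr lborel borel (\<lambda>p. vector [fst p, snd p])"
proof (rule lborel_eqI)
  have meas[measurable]: "(\<lambda>p::real\<times>real. vector [fst p, snd p] :: real^2) \<in> borel_measurable borel"
    using continuous_on_vector2 by (rule borel_measurable_continuous_onI)
  fix l u :: "real^2" assume le: "\<And>b. b \<in> Basis \<Longrightarrow> l \<bullet> b \<le> u \<bullet> b"
  have le': "l $ i \<le> u $ i" for i
    using le[of "axis i 1"] by (simp add: inner_axis axis_in_Basis_iff)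
  have eq: "(\<lambda>p::real\<times>real. vector [fst p, snd p] :: real^2) -` box l u = box (l$1, l$2) (u$1, u$2)"
  proof (rule set_eqI)
    fix p :: "real \<times> real"
    have "p \<in> box (l$1, l$2) (u$1, u$2) \<longleftrightarrow>
        l$1 < fst p \<and> fst p < u$1 \<and> l$2 < snd p \<and> snd p < u$2"
      by (cases p) (auto simp: box_def Basis_prod_def)
    thus "p \<in> (\<lambda>p. vector [fst p, snd p]) -` box l u \<longleftrightarrow> p \<in> box (l$1, l$2) (u$1, u$2)"
      by (auto simp: mem_box_cart forall_2)
  qed
  have "emeasure (distr lborel borel (\<lambda>p. vector [fst p, snd p])) (box l u)
      = emeasure lborel (box (l$1, l$2) (u$1, u$2))"
    by (subst emeasure_distr) (auto simp: eq)
  also have "\<dots> = ennreal ((u$1 - l$1) * (u$2 - l$2))"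
    using le' by (subst emeasure_lborel_box)
      (auto simp: Basis_prod_def prod.union_disjoint)
  also have "(u$1 - l$1) * (u$2 - l$2) = (\<Prod>b\<in>Basis. (u - l) \<bullet> b)"
  proof -
    have "(\<Prod>b\<in>Basis. (u - l) \<bullet> b) = (\<Prod>i\<in>UNIV. (u - l) \<bullet> axis i 1)"
      by (rule prod.reindex_cong[of "\<lambda>i. axis i 1"]) (auto simp: Basis_vec_def inj_on_def axis_eq_axis)
    thus ?thesis by (simp add: inner_axis UNIV_2)
  qed
  finally show "emeasure (distr lborel borel (\<lambda>p. vector [fst p, snd p])) (box l u)
      = (\<Prod>b\<in>Basis. (u - l) \<bullet> b)" .
qed simp

lemma nn_integral_deriv_square_finite:
  assumes S: "open S" and g: "g holomorphic_on S" "inj_on g S" and bdd: "bounded (g ` S)"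
  shows "(\<integral>\<^sup>+p. indicator S (Complex (fst p) (snd p)) *
            ennreal (cmod (deriv g (Complex (fst p) (snd p))) ^ 2) \<partial>lborel) < \<infinity>"
proof -
  define V :: "real^2 \<Rightarrow> complex" where "V = (\<lambda>v. Complex (v$1) (v$2))"
  define U :: "complex \<Rightarrow> real^2" where "U = (\<lambda>z. vector [Re z, Im z])"
  have UV [simp]: "U (V v) = v" "V (U z) = z" for v z
    by (auto simp: U_def V_def vec_eq_iff forall_2)
  have linV: "bounded_linear V" 
    by (rule linear_conv_bounded_linear[THEN iffD1])
       (auto simp: V_def linear_iff complex_eq_iff)
  have linU: "bounded_linear U"
    by (rule linear_conv_bounded_linear[THEN iffD1])
       (auto simp: U_def linear_iff vec_eq_iff forall_2)
  define S' where "S' = V -` S"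
  have contV: "continuous_on UNIV V" using linV by (rule linear_continuous_on)
  have oS': "open S'" unfolding S'_def
    using contV S by (simp add: open_vimage)
  \<comment> \<open>The real derivative is complex multiplication by g'. For g' = a + ib its matrix
    has determinant a^2 + b^2.\<close>
  define G' where "G' = (\<lambda>v h. U (deriv g (V v) * V h))"
  have der: "((\<lambda>v. U (g (V v))) has_derivative G' v) (at v within S')" if "v \<in> S'" for v
  proof -
    have "(g has_derivative (*) (deriv g (V v))) (at (V v))"
      using holomorphic_derivI[OF g(1) S, of "V v"] that
      by (simp add: S'_def has_field_derivative_def)
    hence "((\<lambda>v. g (V v)) has_derivative (\<lambda>h. deriv g (V v) * V h)) (at v within S')"
      by (intro has_derivative_compose[OF bounded_linear_imp_has_derivative[OF linV], of _ _ _ S'])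
         (auto simp: has_derivative_at_withinI)
    thus ?thesis unfolding G'_def
      by (rule bounded_linear.has_derivative[OF linU])
  qed
  have det: "\<bar>det (matrix (G' v))\<bar> = cmod (deriv g (V v)) ^ 2" for v
  proof -
    have "det (matrix (G' v)) = cmod (deriv g (V v)) ^ 2"
      by (simp add: det_2 matrix_def G'_def U_def V_def axis_def cmod_power2)
         (simp add: power2_eq_square)
    thus ?thesis by simp
  qed
  have inj: "inj_on (\<lambda>v. U (g (V v))) S'"
    using g(2) by (auto simp: inj_on_def S'_def) (metis UV)
  have img: "(\<lambda>v. U (g (V v))) ` S' = U ` (g ` S)"
    by (auto simp: S'_def image_iff) (metis UV(2) vimageI)
  have "bounded (U ` (g ` S))"
    using bdd linU by (rule bounded_linear_image)
  moreover have "open (U ` (g ` S))"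
  proof -
    have "open (g ` S)" using open_mapping_thm3 g S by blast
    moreover have "U ` (g ` S) = V -` (g ` S)" by (auto simp: image_iff) (metis UV(1))
    ultimately show ?thesis using contV by (simp add: open_vimage)
  qed
  ultimately have "(\<lambda>v. U (g (V v))) ` S' \<in> lmeasurable"
    unfolding img by (rule lmeasurable_open)
  \<comment> \<open>For an injective differentiable map, the image has finite measure exactly when
    the absolute Jacobian is integrable. Here the image is open and bounded, which yields
    integrability.\<close>
  hence "(\<lambda>v. cmod (deriv g (V v)) ^ 2) integrable_on S'"
    using measurable_differentiable_image_eq[OF _ der inj] oS' by (simp add: det)
  then obtain I where I: "((\<lambda>v. cmod (deriv g (V v)) ^ 2) has_integral I) S'" by blast
  have "(\<integral>\<^sup>+v. ennreal (cmod (deriv g (V v)) ^ 2) * indicator S' v \<partial>lborel) = ennreal I"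
    using I by (intro nn_integral_has_integral_lebesgue') auto
  moreover have "(\<integral>\<^sup>+v. ennreal (cmod (deriv g (V v)) ^ 2) * indicator S' v \<partial>lborel)
     = (\<integral>\<^sup>+p. ennreal (cmod (deriv g (Complex (fst p) (snd p))) ^ 2) * indicator S (Complex (fst p) (snd p)) \<partial>lborel)"
  proof (subst lborel_vec2_eq_distr, subst nn_integral_distr)
    show "(\<lambda>p. vector [fst p, snd p] :: real^2) \<in> lborel \<rightarrow>\<^sub>M borel"
      using continuous_on_vector2 by (simp add: borel_measurable_continuous_onI)
    have "continuous_on S' (\<lambda>v. cmod (deriv g (V v)) ^ 2)"
      using g(1) S contV
      by (intro continuous_intros continuous_on_compose2[OF holomorphic_on_imp_continuous_on[OF holomorphic_deriv[OF g(1) S]], of _ V])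
         (auto simp: S'_def intro: continuous_on_subset)
    hence "(\<lambda>v. indicator S' v *\<^sub>R cmod (deriv g (V v)) ^ 2) \<in> borel_measurable borel"
      using oS' by (intro borel_measurable_continuous_on_indicator) auto
    hence "(\<lambda>v. ennreal (indicator S' v *\<^sub>R cmod (deriv g (V v)) ^ 2)) \<in> borel_measurable borel"
      by measurable
    also have "(\<lambda>v. ennreal (indicator S' v *\<^sub>R cmod (deriv g (V v)) ^ 2)) = 
       (\<lambda>v. ennreal (cmod (deriv g (V v)) ^ 2) * indicator S' v)"
      by (auto simp: indicator_def)
    finally show "(\<lambda>v. ennreal (cmod (deriv g (V v)) ^ 2) * indicator S' v) \<in> borel_measurable (distr lborel borel (\<lambda>p. vector [fst p, snd p]))"
      by simp
  qed (simp add: V_def S'_def indicator_def)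
  ultimately show ?thesis by (simp add: mult.commute) (metis ennreal_less_top)
qed

section \<open>A lower bound for the logarithmic energy\<close>

text \<open>The weight 1/y turns dx dy into d(slope) dy: with x = t + \<sigma> y one has dx = y
  d\<sigma>. Integrating against this kernel is integrating along all rays from \<open>t\<close> of
  slope parameter \<sigma> in (-1, 1), up to height \<open>Y\<close>.\<close>

definition cone_kernel :: "real \<Rightarrow> real \<Rightarrow> real \<times> real \<Rightarrow> real" where
  "cone_kernel Y t p = (if 0 < snd p \<and> snd p < Y \<and> \<bar>fst p - t\<bar> < snd p then 1 / snd p else 0)"

lemma cone_kernel_nonneg [simp]: "cone_kernel Y t p \<ge> 0"
  by (simp add: cone_kernel_def)

lemma cone_kernel_measurable [measurable (raw)]:
  assumes [measurable]: "f \<in> borel_measurable M" "g \<in> M \<rightarrow>\<^sub>M borel"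
  shows "(\<lambda>x. cone_kernel Y (f x) (g x)) \<in> borel_measurable M"
proof -
  have [measurable]: "(\<lambda>x. fst (g x)) \<in> borel_measurable M" "(\<lambda>x. snd (g x)) \<in> borel_measurable M"
    using measurable_compose[OF assms(2) borel_measurable_continuous_onI[of fst]]
      measurable_compose[OF assms(2) borel_measurable_continuous_onI[of snd]]
    by (auto simp: continuous_on_fst continuous_on_snd)
  show ?thesis unfolding cone_kernel_def by measurable
qed

text \<open>The cones with vertices \<open>s\<close> and \<open>t\<close> do not meet below the
  height d = |s - t| / 2. At a height y above it they share a segment of length at most 2y, on which
  the product of the kernels is 1/y^2. Integrating 2/y from d to \<open>Y\<close> produces the
  logarithm.\<close>

lemma nn_integral_cone_kernel_prod:
  assumes st: "s \<noteq> t" "\<bar>s - t\<bar> \<le> M" "2 * Y \<le> M"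
  shows "(\<integral>\<^sup>+p. ennreal (cone_kernel Y s p) * ennreal (cone_kernel Y t p) \<partial>lborel)
           \<le> ennreal (2 * ln (M / \<bar>s - t\<bar>))"
proof -
  define d where "d = \<bar>s - t\<bar> / 2"
  have d: "d > 0" "2 * d \<le> M" using st by (auto simp: d_def)
  have inner: "(\<integral>\<^sup>+x. ennreal (cone_kernel Y s (x, y)) * ennreal (cone_kernel Y t (x, y)) \<partial>lborel)
      \<le> ennreal (2 / y) * indicator {d..Y} y" for y
  proof (cases "d \<le> y \<and> y \<le> Y")
    case True
    hence y: "y > 0" using d by simp
    have "(\<integral>\<^sup>+x. ennreal (cone_kernel Y s (x, y)) * ennreal (cone_kernel Y t (x, y)) \<partial>lborel)
       \<le> (\<integral>\<^sup>+x. ennreal (1 / y\<^sup>2) * indicator {t - y .. t + y} x \<partial>lborel)"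
      using y by (intro nn_integral_mono)
        (auto simp: cone_kernel_def indicator_def power2_eq_square simp flip: ennreal_mult)
    also have "\<dots> = ennreal (1 / y\<^sup>2 * (2 * y))"
      using y by (subst nn_integral_cmult_indicator) (auto simp flip: ennreal_mult)
    also have "1 / y\<^sup>2 * (2 * y) = 2 / y" using y by (simp add: power2_eq_square)
    finally show ?thesis using True by simp
  next
    case False
    have "cone_kernel Y s (x, y) * cone_kernel Y t (x, y) = 0" for x
      using False by (auto simp: cone_kernel_def d_def)
    hence "ennreal (cone_kernel Y s (x, y)) * ennreal (cone_kernel Y t (x, y)) = 0" for x
      by (simp flip: ennreal_mult)
    hence "(\<integral>\<^sup>+x. ennreal (cone_kernel Y s (x, y)) * ennreal (cone_kernel Y t (x, y)) \<partial>lborel) = 0"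
      by (simp only: nn_integral_const mult_zero_left)
    thus ?thesis by simp
  qed
  have "(\<integral>\<^sup>+p. ennreal (cone_kernel Y s p) * ennreal (cone_kernel Y t p) \<partial>lborel)
      = (\<integral>\<^sup>+y. \<integral>\<^sup>+x. ennreal (cone_kernel Y s (x, y)) * ennreal (cone_kernel Y t (x, y)) \<partial>lborel \<partial>lborel)"
    unfolding lborel_prod[symmetric]
    by (subst lborel_pair.nn_integral_snd[symmetric]) (simp_all add: lborel_prod)
  also have "\<dots> \<le> (\<integral>\<^sup>+y. ennreal (2 / y) * indicator {d..Y} y \<partial>lborel)"
    by (intro nn_integral_mono inner)
  also have "\<dots> \<le> ennreal (2 * ln (M / \<bar>s - t\<bar>))"
  proof (cases "d \<le> Y")
    case True
    have "(\<integral>\<^sup>+y. ennreal (2 / y) * indicator {d..Y} y \<partial>lborel) = ennreal (2 * ln Y - 2 * ln d)"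
      using d True
      by (intro nn_integral_FTC_Icc) (auto intro!: derivative_eq_intros)
    also have "2 * ln Y - 2 * ln d = 2 * ln (2 * Y / (2 * d))"
      using d True by (simp add: ln_div)
    also have "ennreal \<dots> \<le> ennreal (2 * ln (M / (2 * d)))"
      using d True st by (intro ennreal_leI) (auto simp: field_simps)
    finally show ?thesis by (simp add: d_def)
  qed auto
  finally show ?thesis .
qed

text \<open>The energy of \<open>\<mu>\<close> is compared with the squared L^2 norm
  \<open>Q\<close> of its potential \<open>P\<close> for the cone kernel. The function
  \<open>\<rho>\<close> serves as a test function: pairing it with \<open>P\<close> and applying
  Cauchy-Schwarz bounds \<open>Q\<close> from below by a^2 / d.\<close>

lemma log_energy_lower_bound:
  fixes \<rho> :: "real \<times> real \<Rightarrow> ennreal"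
  assumes \<mu>: "prob_space \<mu>" "sets \<mu> = sets borel" "emeasure \<mu> K = 1"
    and K: "K \<in> sets borel" "\<And>z. z \<in> K \<Longrightarrow> Im z = 0"
      "\<And>z w. z \<in> K \<Longrightarrow> w \<in> K \<Longrightarrow> cmod (z - w) \<le> M"
    and M: "M \<ge> 1" "2 * Y \<le> M"
    and \<rho>[measurable]: "\<rho> \<in> borel_measurable borel"
    and a: "a \<ge> 0" "\<And>z. z \<in> K \<Longrightarrow> ennreal a \<le> (\<integral>\<^sup>+p. \<rho> p * ennreal (cone_kernel Y (Re z) p) \<partial>lborel)"
    and d: "d > 0" "(\<integral>\<^sup>+p. \<rho> p ^ 2 \<partial>lborel) \<le> ennreal d"
  shows "ereal (a\<^sup>2 / (2 * d) - ln M) \<le> log_energy \<mu>"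
proof -
  interpret prob_space \<mu> by fact
  note [measurable_cong] = \<mu>(2)
  interpret P: pair_sigma_finite \<mu> "lborel :: (real \<times> real) measure" ..
  define k :: "complex \<Rightarrow> real \<times> real \<Rightarrow> ennreal" where "k = (\<lambda>z p. ennreal (cone_kernel Y (Re z) p))"
  have k_meas [measurable (raw)]: "(\<lambda>x. k (f x) (g x)) \<in> borel_measurable N"
    if [measurable]: "f \<in> borel_measurable N" "g \<in> N \<rightarrow>\<^sub>M borel" for f g and N :: "'z measure"
    unfolding k_def by measurable
  have AE_K: "AE z in \<mu>. z \<in> K"
    using \<mu> K(1) by (intro AE_prob_1) (auto simp: measure_def)
  define Q where "Q = (\<integral>\<^sup>+z. \<integral>\<^sup>+w. \<integral>\<^sup>+p. k z p * k w p \<partial>lborel \<partial>\<mu> \<partial>\<mu>)"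
  define P where "P = (\<lambda>p. \<integral>\<^sup>+z. k z p \<partial>\<mu>)"
  have [measurable]: "P \<in> borel_measurable borel"
    unfolding P_def by measurable
  have P2: "(\<integral>\<^sup>+p. P p ^ 2 \<partial>lborel) = Q"
  proof -
    have "P p ^ 2 = (\<integral>\<^sup>+z. \<integral>\<^sup>+w. k z p * k w p \<partial>\<mu> \<partial>\<mu>)" for p
      by (simp add: nn_integral_cmult nn_integral_multc P_def power2_eq_square)
    hence "(\<integral>\<^sup>+p. P p ^ 2 \<partial>lborel) = (\<integral>\<^sup>+p. \<integral>\<^sup>+z. \<integral>\<^sup>+w. k z p * k w p \<partial>\<mu> \<partial>\<mu> \<partial>lborel)"
      by simp
    also have "\<dots> = (\<integral>\<^sup>+z. \<integral>\<^sup>+p. \<integral>\<^sup>+w. k z p * k w p \<partial>\<mu> \<partial>lborel \<partial>\<mu>)"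
      by (rule P.Fubini') measurable
    also have "\<dots> = Q"
      unfolding Q_def by (intro nn_integral_cong P.Fubini') measurable
    finally show ?thesis .
  qed
  have "ennreal a = (\<integral>\<^sup>+z. ennreal a \<partial>\<mu>)"
    by (simp add: emeasure_space_1)
  also have "\<dots> \<le> (\<integral>\<^sup>+z. \<integral>\<^sup>+p. \<rho> p * k z p \<partial>lborel \<partial>\<mu>)"
    using AE_K a(2) by (intro nn_integral_mono_AE) (auto simp: k_def)
  also have "\<dots> = (\<integral>\<^sup>+p. \<integral>\<^sup>+z. \<rho> p * k z p \<partial>\<mu> \<partial>lborel)"
    by (rule P.Fubini'[symmetric]) measurable
  also have "\<dots> = (\<integral>\<^sup>+p. \<rho> p * P p \<partial>lborel)"
    by (simp add: nn_integral_cmult P_def)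
  finally have "ennreal a ^ 2 \<le> (\<integral>\<^sup>+p. \<rho> p * P p \<partial>lborel) ^ 2"
    by (intro power_mono) auto
  also have "\<dots> \<le> (\<integral>\<^sup>+p. \<rho> p ^ 2 \<partial>lborel) * (\<integral>\<^sup>+p. P p ^ 2 \<partial>lborel)"
    by (rule Cauchy_Schwarz_nn_integral) auto
  also have "\<dots> \<le> ennreal d * Q"
    unfolding P2 by (intro mult_right_mono d) auto
  finally have aQ: "ennreal (a\<^sup>2) \<le> ennreal d * Q"
    using a by (simp add: ennreal_power)

  define p :: "complex \<Rightarrow> complex \<Rightarrow> ennreal" where
    "p = (\<lambda>z w. if z = w then \<infinity> else ennreal (max 0 (- ln (cmod (z - w)))))"
  define q :: "complex \<Rightarrow> complex \<Rightarrow> ennreal" where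
    "q = (\<lambda>z w. if z = w then 0 else ennreal (max 0 (ln (cmod (z - w)))))"
  have [measurable]: "(\<lambda>x. p (fst x) (snd x)) \<in> borel_measurable (\<mu> \<Otimes>\<^sub>M \<mu>)"
      "(\<lambda>x. q (fst x) (snd x)) \<in> borel_measurable (\<mu> \<Otimes>\<^sub>M \<mu>)"
    unfolding p_def q_def by measurable
  have pm[measurable]: "p z \<in> borel_measurable \<mu>" "q z \<in> borel_measurable \<mu>" for z
    unfolding p_def q_def by measurable
  have [measurable]: "(\<lambda>z. \<integral>\<^sup>+w. p z w \<partial>\<mu>) \<in> borel_measurable \<mu>" "(\<lambda>z. \<integral>\<^sup>+w. q z w \<partial>\<mu>) \<in> borel_measurable \<mu>"
    unfolding p_def q_def by measurable
  define A where "A = (\<integral>\<^sup>+z. \<integral>\<^sup>+w. p z w \<partial>\<mu> \<partial>\<mu>)"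
  define B where "B = (\<integral>\<^sup>+z. \<integral>\<^sup>+w. q z w \<partial>\<mu> \<partial>\<mu>)"
  have energy: "log_energy \<mu> = enn2ereal A - enn2ereal B"
    unfolding log_energy_def A_def B_def p_def q_def by simp

  \<comment> \<open>The positive and negative parts of the logarithm stand on opposite sides, so
    that nothing is subtracted in \<open>ennreal\<close>. Off the diagonal this is ln (M/r) = ln M -
    ln r with r = |z - w|; on the diagonal \<open>p\<close> is infinite.\<close>
  have pt: "(\<integral>\<^sup>+p. k z p * k w p \<partial>lborel) + 2 * q z w \<le> 2 * ennreal (ln M) + 2 * p z w"
    if "z \<in> K" "w \<in> K" for z w
  proof (cases "z = w")
    case False
    have Im: "Im (z - w) = 0" using K(2) that by simp
    have cm: "cmod (z - w) = \<bar>Re z - Re w\<bar>" using Im by (simp add: cmod_def)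
    define r where "r = cmod (z - w)"
    have r: "r > 0" "r \<le> M" using False K(3) that by (auto simp: r_def)
    have "(\<integral>\<^sup>+p. k z p * k w p \<partial>lborel) \<le> ennreal (2 * ln (M / r))"
      unfolding k_def r_def cm using False r M cm
      by (intro nn_integral_cone_kernel_prod) (auto simp: r_def)
    hence "(\<integral>\<^sup>+p. k z p * k w p \<partial>lborel) + 2 * q z w
        \<le> ennreal (2 * ln (M / r)) + 2 * q z w"
      by (intro add_right_mono)
    also have "\<dots> = ennreal (2 * ln (M / r)) + ennreal 2 * ennreal (max 0 (ln r))"
      using False by (simp add: q_def r_def)
    also have "\<dots> = ennreal (2 * ln (M / r) + 2 * max 0 (ln r))"
      using r by (simp add: ennreal_mult' ennreal_plus flip: ennreal_mult)
    also have "2 * ln (M / r) + 2 * max 0 (ln r) = 2 * ln M + 2 * max 0 (- ln r)"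
      using r M by (simp add: ln_div max_def)
    also have "ennreal \<dots> = ennreal 2 * ennreal (ln M) + ennreal 2 * ennreal (max 0 (- ln r))"
      using M by (simp add: ennreal_mult' flip: ennreal_mult)
    also have "\<dots> = 2 * ennreal (ln M) + 2 * p z w"
      using False by (simp add: p_def r_def)
    finally show ?thesis .
  qed (auto simp: p_def)

  have main: "Q + 2 * B \<le> 2 * ennreal (ln M) + 2 * A"
  proof -
    have "Q + 2 * B = (\<integral>\<^sup>+z. \<integral>\<^sup>+w. (\<integral>\<^sup>+p. k z p * k w p \<partial>lborel) + 2 * q z w \<partial>\<mu> \<partial>\<mu>)"
      unfolding Q_def B_def by (simp add: nn_integral_add nn_integral_cmult)
    also have "\<dots> \<le> (\<integral>\<^sup>+z. \<integral>\<^sup>+w. 2 * ennreal (ln M) + 2 * p z w \<partial>\<mu> \<partial>\<mu>)"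
      using AE_K
    proof (intro nn_integral_mono_AE, eventually_elim)
      fix z assume z: "z \<in> K"
      show "(\<integral>\<^sup>+w. (\<integral>\<^sup>+p. k z p * k w p \<partial>lborel) + 2 * q z w \<partial>\<mu>)
          \<le> (\<integral>\<^sup>+w. 2 * ennreal (ln M) + 2 * p z w \<partial>\<mu>)"
        using AE_K by (intro nn_integral_mono_AE, eventually_elim) (rule pt[OF z])
    qed
    also have "\<dots> = 2 * ennreal (ln M) + 2 * A"
      unfolding A_def by (simp add: nn_integral_add nn_integral_cmult emeasure_space_1)
    finally show ?thesis .
  qed
  \<comment> \<open>Since \<open>K\<close> has diameter at most \<open>M\<close>, the part of the
    energy from distances above 1 is finite. Hence the difference defining the energy is never
    infinity minus infinity.\<close>
  have "B \<le> (\<integral>\<^sup>+z. \<integral>\<^sup>+w. ennreal (ln M) \<partial>\<mu> \<partial>\<mu>)"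
    unfolding B_def using AE_K
  proof (intro nn_integral_mono_AE, eventually_elim)
    fix z assume z: "z \<in> K"
    show "(\<integral>\<^sup>+w. q z w \<partial>\<mu>) \<le> (\<integral>\<^sup>+w. ennreal (ln M) \<partial>\<mu>)"
      using AE_K
    proof (intro nn_integral_mono_AE, eventually_elim)
      fix w assume w: "w \<in> K"
      show "q z w \<le> ennreal (ln M)"
        using K(3)[OF z w] M by (auto simp: q_def intro!: ennreal_leI)
    qed
  qed
  hence "B \<le> ennreal (ln M)" by (simp add: emeasure_space_1)
  then obtain b where b: "B = ennreal b" "b \<ge> 0"
    by (metis ennreal_cases ennreal_less_top leD top.extremum_unique)
  show ?thesis
  proof (cases A rule: ennreal_cases)
    case top
    thus ?thesis by (simp add: energy b)
  next
    case (real al)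
    have "Q \<le> Q + 2 * B" by simp
    also have "\<dots> \<le> 2 * ennreal (ln M) + 2 * A" by (rule main)
    also have "\<dots> < \<infinity>" using real by (simp add: ennreal_mult_less_top)
    finally obtain Qr where Q: "Q = ennreal Qr" "Qr \<ge> 0"
      by (cases Q rule: ennreal_cases) auto
    have "ennreal (Qr + 2 * b) \<le> ennreal (2 * ln M + 2 * al)"
      using main Q b real M by (simp add: ennreal_mult')
    hence 1: "Qr + 2 * b \<le> 2 * ln M + 2 * al"
      using M real by (subst (asm) ennreal_le_iff) auto
    have "ennreal (a\<^sup>2) \<le> ennreal (d * Qr)"
      using aQ Q d by (simp add: ennreal_mult')
    hence "a\<^sup>2 \<le> d * Qr" using d Q by (subst (asm) ennreal_le_iff) auto
    hence "a\<^sup>2 / (2 * d) \<le> Qr / 2" using d by (simp add: field_simps)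
    hence "a\<^sup>2 / (2 * d) - ln M \<le> al - b" using 1 by simp
    thus ?thesis using real b by (simp add: energy enn2ereal_ennreal)
  qed
qed

text \<open>A common lower bound for all energies bounds every Robin constant from below. A supremum
  of reals is informative only for a nonempty set that is bounded above: the bound
  \<open>exp (- r)\<close> gives the latter, and the empty compact set the former, together with
  nonnegativity.\<close>

lemma log_capacity_le:
  assumes r: "\<And>K \<mu>. compact K \<Longrightarrow> K \<subseteq> E \<Longrightarrow> prob_space \<mu> \<Longrightarrow> sets \<mu> = sets borel \<Longrightarrow>
      emeasure \<mu> K = 1 \<Longrightarrow> ereal r \<le> log_energy \<mu>"
  shows "0 \<le> log_capacity E" "log_capacity E \<le> exp (- r)"
proof -
  have le: "cap_compact K \<le> exp (- r)" if K: "compact K" "K \<subseteq> E" for K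
  proof (cases "robin_constant K = \<infinity>")
    case False
    have "ereal r \<le> robin_constant K"
      unfolding robin_constant_def using r[OF K] by (intro INF_greatest) auto
    hence "r \<le> real_of_ereal (robin_constant K)"
      using False by (cases "robin_constant K") auto
    thus ?thesis using False by (simp add: cap_compact_def)
  qed (simp add: cap_compact_def)
  \<comment> \<open>No measure gives the empty set mass 1, so the infimum runs over the empty family
    and equals infinity.\<close>
  have 0: "cap_compact {} = 0"
    by (simp add: cap_compact_def robin_constant_def top_ereal_def)
  have mem: "0 \<in> {cap_compact K | K. compact K \<and> K \<subseteq> E}"
    using 0 by (metis (mono_tags, lifting) mem_Collect_eq compact_empty empty_subsetI)
  have "bdd_above {cap_compact K | K. compact K \<and> K \<subseteq> E}"
    using le by (intro bdd_aboveI[of _ "exp (- r)"]) auto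
  thus "0 \<le> log_capacity E" unfolding log_capacity_def
    using mem by (intro cSup_upper) auto
  show "log_capacity E \<le> exp (- r)" unfolding log_capacity_def
    using mem le by (intro cSup_least) auto
qed

section \<open>The truncated derivative along rays and cones\<close>

definition truncated_deriv :: "(complex \<Rightarrow> complex) \<Rightarrow> real \<Rightarrow> real \<times> real \<Rightarrow> real" where
  "truncated_deriv g eps p =
     (let z = Complex (fst p) (snd p) in
      if snd p > 0 \<and> cmod (g z) < eps then cmod (deriv g z) else 0)"

lemma truncated_deriv_nonneg [simp]: "truncated_deriv g eps p \<ge> 0"
  by (simp add: truncated_deriv_def Let_def)

lemma open_upper_half_plane: "open upper_half_plane"
  unfolding upper_half_plane_def by (rule open_halfspace_Im_gt)

lemma open_sublevel:
  assumes "g holomorphic_on upper_half_plane"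
  shows "open {z \<in> upper_half_plane. cmod (g z) < eps}"
proof -
  have "open (upper_half_plane \<inter> (\<lambda>z. cmod (g z)) -` {..<eps})"
    using assms open_upper_half_plane
    by (intro continuous_open_preimage continuous_intros holomorphic_on_imp_continuous_on) auto
  also have "upper_half_plane \<inter> (\<lambda>z. cmod (g z)) -` {..<eps} = {z \<in> upper_half_plane. cmod (g z) < eps}"
    by auto
  finally show ?thesis .
qed

lemma truncated_deriv_measurable [measurable]:
  assumes g: "g holomorphic_on upper_half_plane"
  shows "truncated_deriv g eps \<in> borel_measurable borel"
proof -
  define S where "S = {z \<in> upper_half_plane. cmod (g z) < eps}"
  define c where "c = (\<lambda>p::real\<times>real. Complex (fst p) (snd p))"
  have S: "open S" "S \<subseteq> upper_half_plane" unfolding S_def using open_sublevel[OF g] by auto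
  have c: "continuous_on UNIV c"
    unfolding c_def Complex_eq by (intro continuous_intros)
  have "continuous_on (c -` S) (\<lambda>p. cmod (deriv g (c p)))"
    using g S(2) c open_upper_half_plane
    by (intro continuous_intros
        continuous_on_compose2[OF holomorphic_on_imp_continuous_on[OF holomorphic_deriv[OF g]], of _ c])
       (auto intro: continuous_on_subset)
  hence "(\<lambda>p. indicator (c -` S) p *\<^sub>R cmod (deriv g (c p))) \<in> borel_measurable borel"
    using open_vimage[OF S(1) c] by (intro borel_measurable_continuous_on_indicator) auto
  also have "(\<lambda>p. indicator (c -` S) p *\<^sub>R cmod (deriv g (c p))) = truncated_deriv g eps"
    by (auto simp: truncated_deriv_def c_def S_def indicator_def upper_half_plane_def Let_def)
  finally show ?thesis .
qed

lemma nn_integral_truncated_deriv_square: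
  assumes g: "g holomorphic_on upper_half_plane" "inj_on g upper_half_plane"
  shows "(\<integral>\<^sup>+p. ennreal (truncated_deriv g eps p) ^ 2 \<partial>lborel) < \<infinity>"
proof -
  define S where "S = {z \<in> upper_half_plane. cmod (g z) < eps}"
  have "(\<integral>\<^sup>+p. indicator S (Complex (fst p) (snd p)) *
            ennreal (cmod (deriv g (Complex (fst p) (snd p))) ^ 2) \<partial>lborel) < \<infinity>"
  proof (rule nn_integral_deriv_square_finite)
    show "open S" unfolding S_def using g(1) by (rule open_sublevel)
    show "g holomorphic_on S" "inj_on g S"
      using g by (auto simp: S_def intro: holomorphic_on_subset inj_on_subset)
    show "bounded (g ` S)"
      by (rule bounded_subset[of "ball 0 eps"]) (auto simp: S_def)
  qed
  also have "(\<lambda>p. indicator S (Complex (fst p) (snd p)) * ennreal (cmod (deriv g (Complex (fst p) (snd p))) ^ 2))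
      = (\<lambda>p. ennreal (truncated_deriv g eps p) ^ 2)"
    by (auto simp: fun_eq_iff truncated_deriv_def S_def indicator_def upper_half_plane_def Let_def ennreal_power)
  finally show ?thesis .
qed

text \<open>On the way up the ray, |g| drops from 3 eps / 4 to eps / 4 along a stretch where it
  stays below \<open>eps\<close>. This drop of eps / 2 forces the integral of |g'| dy to be at least
  eps / 4, because the ray parametrised by height has speed |x + i| at most 2.\<close>

lemma truncated_deriv_ray:
  assumes g: "g holomorphic_on upper_half_plane" and eps: "eps > 0" and Y: "Y > 0"
    and x: "\<bar>x\<bar> < 1"
    and lim: "has_angular_limit g t L" "cmod L \<ge> eps"
    and top: "cmod (g (Complex (t + x * Y) Y)) \<le> eps / 4"
  shows "ennreal (eps / 4) \<le>
    (\<integral>\<^sup>+y. ennreal (truncated_deriv g eps (t + x * y, y)) * indicator {0<..<Y} y \<partial>lborel)"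
proof -
  define z where "z = (\<lambda>y. Complex (t + x * y) y)"
  have z_eq: "z y = of_real t + of_real y * (of_real x + \<i>)" for y
    by (simp add: z_def complex_eq_iff)
  define h where "h = (\<lambda>y. cmod (g (z y)))"
  \<comment> \<open>A ray with |x| < 1 lies in the Stolz angle with k = 1, so \<open>g\<close> tends
    to the angular limit along it.\<close>
  have "filterlim z (at (of_real t) within stolz_angle t 1) (at_right 0)"
    unfolding filterlim_at
  proof
    show "(z \<longlongrightarrow> of_real t) (at_right 0)"
      unfolding z_eq[abs_def] by (auto intro!: tendsto_eq_intros)
    have "eventually (\<lambda>y::real. y > 0) (at_right 0)"
      by (simp add: eventually_at_right_less)
    thus "\<forall>\<^sub>F y in at_right 0. z y \<in> stolz_angle t 1 \<and> z y \<noteq> of_real t"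
    proof eventually_elim
      fix y :: real assume "y > 0"
      thus "z y \<in> stolz_angle t 1 \<and> z y \<noteq> of_real t"
        using x by (auto simp: z_def stolz_angle_def complex_eq_iff abs_mult)
    qed
  qed
  moreover have "(g \<longlongrightarrow> L) (at (of_real t) within stolz_angle t 1)"
    using lim(1) by (simp add: has_angular_limit_def)
  ultimately have "((\<lambda>y. g (z y)) \<longlongrightarrow> L) (at_right 0)"
    by (rule filterlim_compose[rotated])
  hence "(h \<longlongrightarrow> cmod L) (at_right 0)"
    unfolding h_def by (rule tendsto_norm)
  hence "eventually (\<lambda>y. h y > 3 / 4 * eps) (at_right 0)"
    using lim(2) eps by (intro order_tendstoD(1)) auto
  moreover have "eventually (\<lambda>y. y \<in> {0<..<Y}) (at_right 0)"
    using Y by (rule eventually_at_right_real)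
  ultimately have "eventually (\<lambda>y. h y > 3 / 4 * eps \<and> y \<in> {0<..<Y}) (at_right 0)"
    by eventually_elim auto
  then obtain y0 where y0: "h y0 > 3 / 4 * eps" "0 < y0" "y0 < Y"
    using eventually_happens[of _ "at_right (0::real)"] by auto
  have zd: "(z has_vector_derivative (of_real x + \<i>)) (at y within A)" for y A
    unfolding z_eq[abs_def] by (auto intro!: derivative_eq_intros simp: has_vector_derivative_def scaleR_conv_of_real)
  have gz: "((\<lambda>y. g (z y)) has_vector_derivative (of_real x + \<i>) * deriv g (z y)) (at y within A)" if "y > 0" for y A
  proof -
    have "(g has_field_derivative deriv g (z y)) (at (z y))"
      using holomorphic_derivI[OF g open_upper_half_plane] that
      by (simp add: z_def upper_half_plane_def)
    from field_vector_diff_chain_within[OF zd has_field_derivative_at_within[OF this]]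
    show ?thesis by (simp add: o_def)
  qed
  have conth: "continuous_on {0<..} h"
    unfolding h_def
    by (intro continuous_intros continuous_at_imp_continuous_on ballI has_vector_derivative_continuous[OF gz]) auto
  \<comment> \<open>After the last point \<open>y1\<close> at which \<open>|g| \<ge> 3\<epsilon>/4\<close> the truncation is inactive.\<close>
  define A where "A = {y \<in> {y0..Y}. h y \<ge> 3 / 4 * eps}"
  have "closed A"
  proof -
    have "closed ({y0..Y} \<inter> h -` {3 / 4 * eps..})"
      using conth y0 by (intro continuous_closed_preimage) (auto intro: continuous_on_subset)
    also have "{y0..Y} \<inter> h -` {3 / 4 * eps..} = A" by (auto simp: A_def)
    finally show ?thesis .
  qed
  moreover have "bounded A" by (rule bounded_subset[of "{y0..Y}"]) (auto simp: A_def)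
  ultimately have "compact A" by (simp add: compact_eq_bounded_closed)
  moreover have "y0 \<in> A" using y0 by (auto simp: A_def)
  ultimately obtain y1 where y1: "y1 \<in> A" "\<And>y. y \<in> A \<Longrightarrow> y \<le> y1"
    using compact_attains_sup[of A] by auto
  have y1': "0 < y1" "y1 \<le> Y" "h y1 \<ge> 3 / 4 * eps" using y1(1) y0(2) by (auto simp: A_def)
  have after: "h y < eps" if "y \<in> {y1<..Y}" for y
  proof (rule ccontr)
    assume "\<not> ?thesis"
    hence "y \<in> A" using that y1' y1 eps by (auto simp: A_def)
    thus False using y1(2) that by force
  qed
  define D where "D = (\<lambda>y. cmod (deriv g (z y)))"
  have contD: "continuous_on {y1..Y} D"
    unfolding D_def z_def Complex_eq using g y1' open_upper_half_plane
    by (intro continuous_intros continuous_on_compose2[OF holomorphic_on_imp_continuous_on[OF holomorphic_deriv[OF g]]])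
       (auto simp: upper_half_plane_def)
  have cm: "cmod (of_real x + \<i>) \<le> 2"
    using norm_triangle_ineq[of "of_real x" \<i>] x by simp
  have FTC: "((\<lambda>y. (of_real x + \<i>) * deriv g (z y)) has_integral (g (z Y) - g (z y1))) {y1..Y}"
    using y1' by (intro fundamental_theorem_of_calculus gz) auto
  have "cmod (integral {y1..Y} (\<lambda>y. (of_real x + \<i>) * deriv g (z y))) \<le> integral {y1..Y} (\<lambda>y. 2 * D y)"
    using cm contD
    by (intro integral_norm_bound_integral has_integral_integrable[OF FTC])
       (auto simp: D_def norm_mult intro!: mult_right_mono integrable_continuous_real continuous_intros)
  hence "cmod (g (z Y) - g (z y1)) \<le> integral {y1..Y} (\<lambda>y. 2 * D y)"
    by (simp only: integral_unique[OF FTC])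
  moreover have "eps / 2 \<le> cmod (g (z Y) - g (z y1))"
    using y1'(3) top norm_triangle_ineq2[of "g (z y1)" "g (z Y)"]
    by (simp add: h_def z_def norm_minus_commute)
  ultimately have "eps / 4 \<le> integral {y1..Y} D"
    by simp
  hence "ennreal (eps / 4) \<le> ennreal (integral {y1..Y} D)"
    by (rule ennreal_leI)
  also have "\<dots> = (\<integral>\<^sup>+y. ennreal (D y) * indicator {y1..Y} y \<partial>lborel)"
    using contD by (intro nn_integral_has_integral_lebesgue'[symmetric] integrable_integral
       integrable_continuous_real) (auto simp: D_def)
  also have "\<dots> \<le> (\<integral>\<^sup>+y. ennreal (truncated_deriv g eps (t + x * y, y)) * indicator {0<..<Y} y \<partial>lborel)"
  \<comment> \<open>The endpoints form a null set and are discarded: at \<open>Y\<close> the open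
    interval on the right gives 0, and at \<open>y1\<close> the bound \<open>after\<close> does not
    apply.\<close>
  proof (rule nn_integral_mono_AE)
    have "AE y in lborel. y \<noteq> y1 \<and> y \<noteq> Y"
      using AE_lborel_singleton[of y1] AE_lborel_singleton[of Y] by eventually_elim auto
    thus "AE y in lborel. ennreal (D y) * indicator {y1..Y} y \<le>
        ennreal (truncated_deriv g eps (t + x * y, y)) * indicator {0<..<Y} y"
    proof eventually_elim
      fix y assume "y \<noteq> y1 \<and> y \<noteq> Y"
      thus "ennreal (D y) * indicator {y1..Y} y \<le>
        ennreal (truncated_deriv g eps (t + x * y, y)) * indicator {0<..<Y} y"
        using after[of y] y1'(1)
        by (auto simp: truncated_deriv_def D_def z_def h_def indicator_def Let_def)
    qed
  qed
  finally show ?thesis .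
qed

text \<open>The ray estimate eps / 4 is integrated over the slopes in (-1, 1), an interval of length
  2; Fubini's theorem turns the integral over rays into one over the cone.\<close>

lemma truncated_deriv_cone:
  assumes g: "g holomorphic_on upper_half_plane" and eps: "eps > 0" and Y: "Y > 0"
    and lim: "has_angular_limit g t L" "cmod L \<ge> eps"
    and top: "\<And>x. \<bar>x\<bar> < 1 \<Longrightarrow> cmod (g (Complex (t + x * Y) Y)) \<le> eps / 4"
  shows "ennreal (eps / 2) \<le>
    (\<integral>\<^sup>+p. ennreal (truncated_deriv g eps p) * ennreal (cone_kernel Y t p) \<partial>lborel)"
proof -
  note [measurable] = truncated_deriv_measurable[OF g, of eps]
  let ?r = "\<lambda>x y. ennreal (truncated_deriv g eps (t + x * y, y))"
  have [measurable]: "(\<lambda>p. truncated_deriv g eps (t + fst p * snd p, snd p))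
      \<in> borel_measurable (lborel \<Otimes>\<^sub>M lborel)"
      "(\<lambda>x. truncated_deriv g eps (x, y)) \<in> borel_measurable borel"
      "(\<lambda>x. truncated_deriv g eps (t + x * y, y)) \<in> borel_measurable borel"
      "(\<lambda>y. truncated_deriv g eps (t + x * y, y)) \<in> borel_measurable borel" for x y
    by (rule measurable_compose[OF _ truncated_deriv_measurable[OF g]];
        simp add: borel_prod[symmetric])+
  \<comment> \<open>At a fixed height y the substitution of t + y x for x contributes the factor y,
    which cancels the weight 1/y of the kernel.\<close>
  have inner: "(\<integral>\<^sup>+x. ennreal (truncated_deriv g eps (x, y)) * ennreal (cone_kernel Y t (x, y)) \<partial>lborel)
     = (\<integral>\<^sup>+x. ?r x y * indicator {0<..<Y} y * indicator {-1<..<1} x \<partial>lborel)" for y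
  proof (cases "0 < y \<and> y < Y")
    case True
    have [measurable]: "(\<lambda>x. cone_kernel Y t (x, y)) \<in> borel_measurable borel"
      by (rule cone_kernel_measurable) (simp_all add: borel_prod[symmetric])
    have "(\<integral>\<^sup>+x. ennreal (truncated_deriv g eps (x, y)) * ennreal (cone_kernel Y t (x, y)) \<partial>lborel)
       = ennreal \<bar>y\<bar> * (\<integral>\<^sup>+x. ennreal (truncated_deriv g eps (t + y * x, y)) * ennreal (cone_kernel Y t (t + y * x, y)) \<partial>lborel)"
      using True by (intro nn_integral_real_affine) auto
    also have "\<dots> = ennreal \<bar>y\<bar> * (\<integral>\<^sup>+x. ennreal (1 / y) * (?r x y * indicator {-1<..<1} x) \<partial>lborel)"
      using True by (intro arg_cong[where f="\<lambda>u. ennreal \<bar>y\<bar> * u"] nn_integral_cong)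
        (auto simp: cone_kernel_def indicator_def abs_mult mult.commute)
    also have "\<dots> = ennreal \<bar>y\<bar> * (ennreal (1 / y) * (\<integral>\<^sup>+x. ?r x y * indicator {-1<..<1} x \<partial>lborel))"
      by (subst nn_integral_cmult) auto
    also have "\<dots> = (\<integral>\<^sup>+x. ?r x y * indicator {-1<..<1} x \<partial>lborel)"
      using True by (simp flip: mult.assoc ennreal_mult)
    finally show ?thesis using True by simp
  qed (auto simp: cone_kernel_def indicator_def)
  have "ennreal (eps / 2) = ennreal (eps / 4) * 2"
    using ennreal_mult[of "eps / 4" 2] eps by simp
  hence "ennreal (eps / 2) = (\<integral>\<^sup>+x. ennreal (eps / 4) * indicator {-1<..<1::real} x \<partial>lborel)"
    by (subst nn_integral_cmult_indicator) auto
  also have "\<dots> \<le> (\<integral>\<^sup>+x. \<integral>\<^sup>+y. ?r x y * indicator {0<..<Y} y * indicator {-1<..<1} x \<partial>lborel \<partial>lborel)"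
  proof (rule nn_integral_mono)
    fix x :: real
    show "ennreal (eps / 4) * indicator {-1<..<1} x
       \<le> (\<integral>\<^sup>+y. ?r x y * indicator {0<..<Y} y * indicator {-1<..<1} x \<partial>lborel)"
      using truncated_deriv_ray[OF g eps Y _ lim top, of x] by (cases "x \<in> {-1<..<1}") auto
  qed
  also have "\<dots> = (\<integral>\<^sup>+y. \<integral>\<^sup>+x. ?r x y * indicator {0<..<Y} y * indicator {-1<..<1} x \<partial>lborel \<partial>lborel)"
    by (rule lborel_pair.Fubini'[symmetric]) (simp add: case_prod_beta')
  also have "\<dots> = (\<integral>\<^sup>+y. \<integral>\<^sup>+x. ennreal (truncated_deriv g eps (x, y)) * ennreal (cone_kernel Y t (x, y)) \<partial>lborel \<partial>lborel)"
    by (simp add: inner)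
  also have "\<dots> = (\<integral>\<^sup>+p. ennreal (truncated_deriv g eps p) * ennreal (cone_kernel Y t p) \<partial>lborel)"
    unfolding lborel_prod[symmetric]
    by (subst lborel_pair.nn_integral_snd[symmetric]) (simp_all add: lborel_prod)
  finally show ?thesis .
qed

section \<open>Summability\<close>

text \<open>The indices of the sets containing a given point lie in a window of \<open>N\<close>
  consecutive integers starting at the smallest of them, so the indicators add up to at most
  \<open>N\<close>.\<close>

lemma suminf_nn_integral_bounded_overlap:
  fixes B :: "nat \<Rightarrow> 'a set" and f :: "'a \<Rightarrow> ennreal"
  assumes f[measurable]: "f \<in> borel_measurable M" and fin: "(\<integral>\<^sup>+x. f x \<partial>M) < \<infinity>"
    and B[measurable]: "\<And>n. B n \<in> sets M"
    and overlap: "\<And>x m n. x \<in> B m \<Longrightarrow> x \<in> B n \<Longrightarrow> n < m + N"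
  shows "(\<Sum>n. \<integral>\<^sup>+x. f x * indicator (B n) x \<partial>M) < \<infinity>"
proof -
  have le: "(\<Sum>n. indicator (B n) x :: ennreal) \<le> of_nat N" for x
    unfolding suminf_eq_SUP
  proof (rule SUP_least)
    fix j :: nat
    define A where "A = {i. i < j \<and> x \<in> B i}"
    have finA: "finite A" by (auto simp: A_def)
    have "(\<Sum>i<j. indicator (B i) x :: ennreal) = (\<Sum>i\<in>A. 1)"
      by (rule sum.mono_neutral_cong_right) (auto simp: A_def)
    also have "\<dots> = of_nat (card A)" by simp
    also have "card A \<le> N"
    proof (cases "A = {}")
      case False
      hence "Min A \<in> A" using finA by simp
      hence "A \<subseteq> {Min A ..< Min A + N}"
        using overlap finA by (auto simp: A_def)
      from card_mono[OF _ this] show ?thesis by simp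
    qed simp
    finally show "(\<Sum>i<j. indicator (B i) x :: ennreal) \<le> of_nat N"
      by simp
  qed
  have "(\<Sum>n. \<integral>\<^sup>+x. f x * indicator (B n) x \<partial>M) = (\<integral>\<^sup>+x. (\<Sum>n. f x * indicator (B n) x) \<partial>M)"
    by (subst nn_integral_suminf) auto
  also have "\<dots> = (\<integral>\<^sup>+x. f x * (\<Sum>n. indicator (B n) x) \<partial>M)"
    by simp
  also have "\<dots> \<le> (\<integral>\<^sup>+x. f x * of_nat N \<partial>M)"
    by (intro nn_integral_mono mult_left_mono le) auto
  also have "\<dots> = (\<integral>\<^sup>+x. f x \<partial>M) * of_nat N"
    by (rule nn_integral_multc) auto
  also have "\<dots> < \<infinity>" using fin by (simp add: ennreal_mult_less_top of_nat_less_top)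
  finally show ?thesis .
qed

text \<open>This is the common form of both claims. The scale \<open>sc n\<close> is lam^n in one
  and 1 in the other, \<open>z n\<close> is the point where \<open>g\<close> is known to be small,
  and \<open>\<kappa>\<close> is the height of the cones relative to the scale. The constant
  \<open>C\<close> bounds lengths and distances relative to the scale, so that all estimates are
  scale invariant.\<close>

lemma summable_inverse_log_capacity:
  fixes g :: "complex \<Rightarrow> complex" and sc l u :: "nat \<Rightarrow> real" and z :: "nat \<Rightarrow> complex"
  assumes g: "g holomorphic_on upper_half_plane" "inj_on g upper_half_plane"
      "\<And>z. z \<in> upper_half_plane \<Longrightarrow> g z \<noteq> 0"
    and eps: "eps > 0"
    and lim0: "(\<lambda>n. g (z n)) \<longlonglongrightarrow> 0"
    and E: "\<And>n t. t \<in> E n \<Longrightarrow> l n \<le> t \<and> t \<le> u n \<and> (\<exists>L. has_angular_limit g t L \<and> cmod L \<ge> eps)"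
    and sc: "\<And>n. sc n \<ge> 1" and \<kappa>: "\<kappa> > 0" "2 * \<kappa> \<le> C" and C: "C \<ge> 1"
    and lu: "\<And>n. u n - l n \<le> C * sc n"
    and z: "\<And>n. \<kappa> * sc n \<le> Im (z n)" "\<And>n. Im (z n) \<le> C * sc n"
      "\<And>n t. l n \<le> t \<Longrightarrow> t \<le> u n \<Longrightarrow> \<bar>t - Re (z n)\<bar> \<le> C * sc n"
    and overlap: "\<And>m n x. x < u m + \<kappa> * sc m \<Longrightarrow> l n - \<kappa> * sc n < x \<Longrightarrow> n < m + N"
  shows "summable (\<lambda>n. let c = log_capacity (complex_of_real ` E n) in
                        if c = 0 then 0 else 1 / ln (sc n / c))"
proof -
  note [measurable] = truncated_deriv_measurable[OF g(1), of eps]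
  \<comment> \<open>A vertical strip that contains every cone of height
    \<open>\<kappa> * sc n\<close> with vertex in the interval from \<open>l n\<close> to
    \<open>u n\<close>.\<close>
  define B where "B = (\<lambda>n. {p::real\<times>real. l n - \<kappa> * sc n < fst p \<and> fst p < u n + \<kappa> * sc n})"
  have B [measurable]: "B n \<in> sets borel" for n
    unfolding B_def by (intro borel_open open_Collect_conj open_Collect_less continuous_intros)
  define \<rho> where "\<rho> = (\<lambda>n p. ennreal (truncated_deriv g eps p) * indicator (B n) p)"
  define I where "I = (\<lambda>n. \<integral>\<^sup>+p. \<rho> n p ^ 2 \<partial>lborel)"
  have "(\<Sum>n. \<integral>\<^sup>+p. ennreal (truncated_deriv g eps p) ^ 2 * indicator (B n) p \<partial>lborel) < \<infinity>"
    using overlap by (intro suminf_nn_integral_bounded_overlap[where N = N] nn_integral_truncated_deriv_square g(1,2))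
      (auto simp: B_def[symmetric], auto simp: B_def)
  also have "(\<lambda>n. \<integral>\<^sup>+p. ennreal (truncated_deriv g eps p) ^ 2 * indicator (B n) p \<partial>lborel) = I"
    unfolding I_def \<rho>_def
    by (intro ext nn_integral_cong) (auto simp: indicator_def)
  finally have sumI: "(\<Sum>n. I n) < \<infinity>" .
  have Ifin: "I n < \<infinity>" for n
    using ennreal_suminf_lessD[OF sumI[unfolded infinity_ennreal_def]] by simp
  \<comment> \<open>The summand \<open>2\<^sup>-\<^sup>n\<close> only serves to make \<open>d n\<close> positive.\<close>
  define d where "d = (\<lambda>n. enn2real (I n) + (1/2) ^ n)"
  have dpos: "d n > 0" for n unfolding d_def by (simp add: add_nonneg_pos)
  have Id: "I n \<le> ennreal (d n)" for n
    using Ifin[of n] by (cases "I n" rule: ennreal_cases) (auto simp: d_def)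
  have "summable (\<lambda>n. enn2real (I n))"
    using sumI Ifin by (intro summable_suminf_not_top) (auto simp: less_top)
  hence sumd: "summable d"
    unfolding d_def by (intro summable_add summable_geometric) auto

  \<comment> \<open>The tops of the cones and \<open>z n\<close> have height at least
    \<open>\<kappa> * sc n\<close> and mutual distance at most
    \<open>2 * (C + \<kappa>) * sc n\<close>. The scale cancels in the growth estimate, which leaves
    a factor independent of n.\<close>
  define R where "R = exp (12 * pi * (2 * (C + \<kappa>)) / \<kappa>)"
  have "(\<lambda>n. R * cmod (g (z n))) \<longlonglongrightarrow> R * 0"
    by (intro tendsto_mult tendsto_const tendsto_norm_zero lim0)
  hence ev1: "eventually (\<lambda>n. R * cmod (g (z n)) < eps / 4) sequentially"
    using eps by (intro order_tendstoD(2)) auto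
  have bound: "0 \<le> log_capacity (complex_of_real ` E n) \<and>
      log_capacity (complex_of_real ` E n) \<le> exp (- ((eps / 2)\<^sup>2 / (2 * d n) - ln (C * sc n)))"
    if n: "R * cmod (g (z n)) < eps / 4" for n
  proof -
    define Y where "Y = \<kappa> * sc n"
    have scn: "sc n > 0" using sc[of n] by simp
    have Y: "Y > 0" using \<kappa> scn by (simp add: Y_def)
    have top: "cmod (g (Complex (t + x * Y) Y)) \<le> eps / 4"
      if t: "l n \<le> t" "t \<le> u n" and x: "\<bar>x\<bar> < 1" for t x
    proof -
      have "cmod (Complex (t + x * Y) Y - z n) \<le> \<bar>(t - Re (z n)) + x * Y\<bar> + \<bar>Y - Im (z n)\<bar>"
        using cmod_le[of "Complex (t + x * Y) Y - z n"] by (simp add: algebra_simps)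
      also have "\<bar>(t - Re (z n)) + x * Y\<bar> \<le> C * sc n + Y"
      proof -
        have "\<bar>x * Y\<bar> \<le> Y" using x Y by (simp add: abs_mult)
        thus ?thesis using z(3)[OF t] by linarith
      qed
      also have "\<bar>Y - Im (z n)\<bar> \<le> C * sc n + Y"
        using z(1,2)[of n] Y by (simp add: Y_def)
      finally have dist: "cmod (Complex (t + x * Y) Y - z n) \<le> 2 * (C + \<kappa>) * sc n"
        by (simp add: Y_def algebra_simps)
      have "cmod (g (Complex (t + x * Y) Y))
         \<le> exp (12 * pi * cmod (Complex (t + x * Y) Y - z n) / Y) * cmod (g (z n))"
        using z(1)[of n] Y by (intro nonvanishing_univalent_growth g) (auto simp: Y_def)
      also have "\<dots> \<le> R * cmod (g (z n))"
      proof (intro mult_right_mono)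
        have "12 * pi * cmod (Complex (t + x * Y) Y - z n) / Y
            \<le> 12 * pi * (2 * (C + \<kappa>) * sc n) / Y"
          using dist Y by (intro divide_right_mono mult_left_mono) auto
        also have "\<dots> = 12 * pi * (2 * (C + \<kappa>)) / \<kappa>"
          using scn by (simp add: Y_def)
        finally show "exp (12 * pi * cmod (Complex (t + x * Y) Y - z n) / Y) \<le> R"
          by (simp add: R_def)
      qed auto
      finally show ?thesis using n by simp
    qed
    have energy: "ereal ((eps / 2)\<^sup>2 / (2 * d n) - ln (C * sc n)) \<le> log_energy \<mu>"
      if K: "compact K" "K \<subseteq> complex_of_real ` E n" and \<mu>: "prob_space \<mu>" "sets \<mu> = sets borel" "emeasure \<mu> K = 1"
      for K \<mu>
    proof (rule log_energy_lower_bound[OF \<mu>, where Y = Y and \<rho> = "\<rho> n"])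
      show "K \<in> sets borel" using K(1) by (simp add: compact_imp_closed borel_closed)
      show "Im w = 0" if "w \<in> K" for w using that K(2) by auto
      show "cmod (v - w) \<le> C * sc n" if vw: "v \<in> K" "w \<in> K" for v w
      proof -
        obtain s t where st: "v = of_real s" "w = of_real t" "s \<in> E n" "t \<in> E n"
          using vw K(2) by blast
        have "cmod (v - w) = \<bar>s - t\<bar>"
          unfolding st of_real_diff[symmetric] by (rule norm_of_real)
        thus ?thesis using E[OF st(3)] E[OF st(4)] lu[of n] by linarith
      qed
      show "1 \<le> C * sc n" using C sc[of n] mult_mono[of 1 C 1 "sc n"] by simp
      show "2 * Y \<le> C * sc n" using \<kappa> scn by (simp add: Y_def)
      show "\<rho> n \<in> borel_measurable borel" unfolding \<rho>_def by measurable
      show "0 \<le> eps / 2" using eps by simp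
      show "0 < d n" by (rule dpos)
      show "(\<integral>\<^sup>+p. \<rho> n p ^ 2 \<partial>lborel) \<le> ennreal (d n)" using Id by (simp add: I_def)
      fix w assume "w \<in> K"
      then obtain t where t: "w = of_real t" "t \<in> E n" using K(2) by blast
      obtain L where L: "has_angular_limit g t L" "cmod L \<ge> eps" using E[OF t(2)] by blast
      have tlu: "l n \<le> t" "t \<le> u n" using E[OF t(2)] by auto
      have "ennreal (eps / 2) \<le> (\<integral>\<^sup>+p. ennreal (truncated_deriv g eps p) * ennreal (cone_kernel Y t p) \<partial>lborel)"
        using tlu by (intro truncated_deriv_cone[OF g(1) eps Y L] top)
      also have "\<dots> = (\<integral>\<^sup>+p. \<rho> n p * ennreal (cone_kernel Y (Re w) p) \<partial>lborel)"
        using tlu by (intro nn_integral_cong)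
          (auto simp: \<rho>_def t cone_kernel_def indicator_def B_def Y_def abs_if split: if_splits)
      finally show "ennreal (eps / 2) \<le> (\<integral>\<^sup>+p. \<rho> n p * ennreal (cone_kernel Y (Re w) p) \<partial>lborel)" .
    qed
    show ?thesis
      by (intro conjI log_capacity_le[where r = "(eps / 2)\<^sup>2 / (2 * d n) - ln (C * sc n)"] energy)
  qed
  have lnC: "ln C \<ge> 0" using C by simp
  have "d \<longlonglongrightarrow> 0" using sumd by (rule summable_LIMSEQ_zero)
  \<comment> \<open>The energy bound contains (eps/2)^2 / (2 d) = eps^2 / (8 d), split below into
    two halves eps^2 / (16 d). For small d one half exceeds ln C + 1 and absorbs the loss ln C; the
    other gives the majorant 16 d / eps^2. The summand 1 keeps the threshold meaningful when C =
    1.\<close>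
  hence ev2: "eventually (\<lambda>n. d n < eps\<^sup>2 / (16 * (ln C + 1))) sequentially"
    using eps lnC by (intro order_tendstoD(2)) (auto intro!: divide_pos_pos mult_pos_pos)
  show ?thesis
  proof (rule summable_comparison_test_ev)
    show "summable (\<lambda>n. 16 / eps\<^sup>2 * d n)" using sumd by (rule summable_mult)
    show "\<forall>\<^sub>F n in sequentially. norm (let c = log_capacity (complex_of_real ` E n) in
        if c = 0 then 0 else 1 / ln (sc n / c)) \<le> 16 / eps\<^sup>2 * d n"
      using ev1 ev2
    proof eventually_elim
      fix n assume n: "R * cmod (g (z n)) < eps / 4" "d n < eps\<^sup>2 / (16 * (ln C + 1))"
      define c where "c = log_capacity (complex_of_real ` E n)"
      show "norm (let c = log_capacity (complex_of_real ` E n) in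
        if c = 0 then 0 else 1 / ln (sc n / c)) \<le> 16 / eps\<^sup>2 * d n"
      proof (cases "c = 0")
        case True
        thus ?thesis using dpos[of n] by (simp add: c_def)
      next
        case False
        have c: "c > 0" "c \<le> exp (- ((eps / 2)\<^sup>2 / (2 * d n) - ln (C * sc n)))"
          using bound[OF n(1)] False by (auto simp: c_def)
        have scn: "sc n > 0" using sc[of n] by simp
        have "ln c \<le> - ((eps / 2)\<^sup>2 / (2 * d n) - ln (C * sc n))"
          using c by (metis exp_le_cancel_iff exp_ln)
        hence "ln (sc n / c) \<ge> (eps / 2)\<^sup>2 / (2 * d n) - ln C"
          using c(1) C scn by (simp add: ln_div ln_mult)
        also have "(eps / 2)\<^sup>2 / (2 * d n) = eps\<^sup>2 / (16 * d n) + eps\<^sup>2 / (16 * d n)"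
          using dpos[of n] by (simp add: field_simps power2_eq_square)
        finally have "eps\<^sup>2 / (16 * d n) + (eps\<^sup>2 / (16 * d n) - ln C) \<le> ln (sc n / c)" by simp
        moreover have "ln C + 1 < eps\<^sup>2 / (16 * d n)"
          using n(2) dpos[of n] lnC by (simp add: field_simps)
        ultimately have ge: "eps\<^sup>2 / (16 * d n) \<le> ln (sc n / c)" by linarith
        have pos: "0 < eps\<^sup>2 / (16 * d n)" using eps dpos[of n] by simp
        have "1 / ln (sc n / c) \<le> 1 / (eps\<^sup>2 / (16 * d n))"
          using ge pos by (intro divide_left_mono mult_pos_pos) auto
        moreover have "1 / ln (sc n / c) \<ge> 0" using ge pos by simp
        ultimately show ?thesis using False by (simp add: c_def[symmetric] Let_def)
      qed
    qed
  qed
qed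

section \<open>The geometric and the arithmetic sequence of intervals\<close>

theorem theorem3p1:
  fixes \<phi> :: "complex \<Rightarrow> complex" and w0 :: complex and lam eps :: real
  assumes conf: "\<phi> holomorphic_on upper_half_plane" "inj_on \<phi> upper_half_plane"
    and w0: "w0 \<notin> \<phi> ` upper_half_plane"
    and hlam: "lam > 1" and heps: "eps > 0"
  defines "E \<equiv> \<lambda>n::nat. {t \<in> {lam powr (real n - 1/2) .. lam powr (real n + 1/2)}.
                   \<exists>L. has_angular_limit \<phi> t L \<and> cmod (L - w0) \<ge> eps}"
    and "F \<equiv> \<lambda>n::nat. {t \<in> {real n - 1/2 .. real n + 1/2}.
                   \<exists>L. has_angular_limit \<phi> t L \<and> cmod (L - w0) \<ge> eps}"
  shows "((\<lambda>n::nat. \<phi> (complex_of_real (lam ^ n) * \<i>)) \<longlonglongrightarrow> w0 \<longrightarrow>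
            summable (\<lambda>n. let c = log_capacity (complex_of_real ` E n) in
                            if c = 0 then 0 else 1 / ln (lam ^ n / c)))
       \<and> ((\<lambda>n::nat. \<phi> (of_nat n + \<i>)) \<longlonglongrightarrow> w0 \<longrightarrow>
            summable (\<lambda>n. let c = log_capacity (complex_of_real ` F n) in
                            if c = 0 then 0 else 1 / ln (1 / c)))"
proof (intro conjI impI)
  define g where "g = (\<lambda>z. \<phi> z - w0)"
  have g: "g holomorphic_on upper_half_plane" "inj_on g upper_half_plane"
      "\<And>z. z \<in> upper_half_plane \<Longrightarrow> g z \<noteq> 0"
    using conf w0 by (auto simp: g_def inj_on_def intro!: holomorphic_intros)
  have ang: "has_angular_limit g t (L - w0)" if "has_angular_limit \<phi> t L" for t L
    using that unfolding has_angular_limit_def g_def by (auto intro!: tendsto_diff)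
  {
    assume lim: "(\<lambda>n::nat. \<phi> (complex_of_real (lam ^ n) * \<i>)) \<longlonglongrightarrow> w0"
    \<comment> \<open>In terms of \<open>s\<close> the interval I_n is [lam^n / s, lam^n s].\<close>
    define s where "s = sqrt lam"
    have s: "s > 1" "s * s = lam" using hlam by (auto simp: s_def)
    have l: "lam powr (real n - 1/2) = lam ^ n / s" and u: "lam powr (real n + 1/2) = lam ^ n * s" for n
      using hlam by (auto simp: s_def powr_diff powr_add powr_realpow powr_half_sqrt)
    \<comment> \<open>The strips of indices m and n can meet only if lam^n < (2 lam + 1) lam^m, and
      2 lam + 1 is below 4 lam.\<close>
    obtain N where N: "4 * lam < lam ^ N" using real_arch_pow[OF hlam] by blast
    have pw: "lam ^ n \<ge> 1" for n using hlam by simp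
    show "summable (\<lambda>n. let c = log_capacity (complex_of_real ` E n) in
                            if c = 0 then 0 else 1 / ln (lam ^ n / c))"
    \<comment> \<open>With \<open>\<kappa> = 1 / (2 * s)\<close> the cones have half the height of
      the left endpoint of I_n, so the strips stay away from 0 and still grow geometrically.\<close>
    proof (rule summable_inverse_log_capacity[OF g heps, where z = "\<lambda>n. complex_of_real (lam ^ n) * \<i>"
          and l = "\<lambda>n. lam ^ n / s" and u = "\<lambda>n. lam ^ n * s" and \<kappa> = "1 / (2 * s)" and C = s and N = N])
      show "(\<lambda>n. g (complex_of_real (lam ^ n) * \<i>)) \<longlonglongrightarrow> 0"
        using lim by (simp add: g_def LIM_zero)
      show "lam ^ n / s \<le> t \<and> t \<le> lam ^ n * s \<and> (\<exists>L. has_angular_limit g t L \<and> eps \<le> cmod L)"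
        if "t \<in> E n" for n t
        using that ang by (auto simp: E_def l u)
      show "1 \<le> lam ^ n" for n by (rule pw)
      show "0 < 1 / (2 * s)" "2 * (1 / (2 * s)) \<le> s" "1 \<le> s"
        using s mult_mono[of 1 s 1 s] by (auto simp: field_simps)
      show "lam ^ n * s - lam ^ n / s \<le> s * lam ^ n" for n
        using s pw[of n] by (simp add: mult.commute)
      show "1 / (2 * s) * lam ^ n \<le> Im (complex_of_real (lam ^ n) * \<i>)" for n
        using s pw[of n] mult_right_mono[of "1 / (2 * s)" 1 "lam ^ n"] by simp
      show "Im (complex_of_real (lam ^ n) * \<i>) \<le> s * lam ^ n" for n
        using s pw[of n] mult_right_mono[of 1 s "lam ^ n"] by simp
      show "\<bar>t - Re (complex_of_real (lam ^ n) * \<i>)\<bar> \<le> s * lam ^ n"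
        if "lam ^ n / s \<le> t" "t \<le> lam ^ n * s" for n t
      proof -
        have "0 \<le> lam ^ n / s" using s pw[of n] by simp
        thus ?thesis using that by (simp add: mult.commute)
      qed
      show "n < m + N" if "x < lam ^ m * s + 1 / (2 * s) * lam ^ m" "lam ^ n / s - 1 / (2 * s) * lam ^ n < x"
        for m n x
      proof (rule ccontr)
        assume "\<not> ?thesis"
        hence "lam ^ (m + N) \<le> lam ^ n" using hlam by (intro power_increasing) auto
        moreover have "4 * lam * lam ^ m < lam ^ N * lam ^ m"
          using N pw[of m] by (intro mult_strict_right_mono) auto
        ultimately have 1: "4 * lam * lam ^ m < lam ^ n" by (simp add: power_add mult.commute)
        have "lam ^ n / s - 1 / (2 * s) * lam ^ n < lam ^ m * s + 1 / (2 * s) * lam ^ m"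
          using that by linarith
        hence "2 * s * (lam ^ n / s - 1 / (2 * s) * lam ^ n) < 2 * s * (lam ^ m * s + 1 / (2 * s) * lam ^ m)"
          using s by (intro mult_strict_left_mono) auto
        also have "2 * s * (lam ^ n / s - 1 / (2 * s) * lam ^ n) = lam ^ n"
          using s by (simp add: field_simps)
        also have "2 * s * (lam ^ m * s + 1 / (2 * s) * lam ^ m) = 2 * lam * lam ^ m + lam ^ m"
          using s(1) unfolding s(2)[symmetric] by (simp add: field_simps)
        finally show False using 1 hlam pw[of m] mult_right_mono[of 1 lam "lam ^ m"] by linarith
      qed
    qed
  }
  {
    assume lim: "(\<lambda>n::nat. \<phi> (of_nat n + \<i>)) \<longlonglongrightarrow> w0"
    show "summable (\<lambda>n. let c = log_capacity (complex_of_real ` F n) in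
                            if c = 0 then 0 else 1 / ln (1 / c))"
    \<comment> \<open>Cones of height 1 give the strips from n - 3/2 to n + 3/2, which are disjoint
      once the indices differ by 3. The value \<open>C = 2\<close> is dictated by
      \<open>2 * \<kappa> \<le> C\<close>.\<close>
    proof (rule summable_inverse_log_capacity[OF g heps, where z = "\<lambda>n. of_nat n + \<i>" and sc = "\<lambda>_. 1"
          and l = "\<lambda>n. real n - 1/2" and u = "\<lambda>n. real n + 1/2" and \<kappa> = 1 and C = 2 and N = 3])
      show "(\<lambda>n. g (of_nat n + \<i>)) \<longlonglongrightarrow> 0"
        using lim by (simp add: g_def LIM_zero)
      show "real n - 1/2 \<le> t \<and> t \<le> real n + 1/2 \<and> (\<exists>L. has_angular_limit g t L \<and> eps \<le> cmod L)"
        if "t \<in> F n" for n t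
        using that ang by (auto simp: F_def)
    qed (auto simp: abs_if)
  }
qed

end
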